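(* Let $A$ be an honest participant, and let $\Gamma$ be a concrete BitML configuration reachable, via the concrete semantics $\to_\flat$, from an initial configuration. Let $\mathcal{X}\subseteq\mathrm{cn}(\Gamma)$ and let $\mathcal R=\Gamma\to_\flat^*\Gamma'$ be a (finite) concrete run. Then there exists a finite (possibly empty, possibly with repetitions) family of recursion variables $\mathsf X_1,\mathsf X_2,\dots$ such that $$\alpha_{A,\mathcal X}(\Gamma)\;\to_\sharp^*\;\alpha_{A,\mathrm{desc}_\Gamma(\mathcal R,\mathcal X)}(\Gamma')\;\big|\;\|_i\,\mathsf X_i .$$
   Context: **Syntax.** Fix: participants $P,Q,\dots$, with a subset $\mathrm{Hon}$ of honest participants; an infinite set of names $x,y,z,\dots$ (used both for deposits and for contracts); deposit variables $d,e,\dots$; secret names $a,b,\dots$, with a set $S_P$ of secret names for each participant $P$, where $S_P\cap S_Q=\emptyset$ if $P\ne Q$; a finite set of recursion variables $\mathsf X,\mathsf Y,\dots$; integer variables $\beta$. $\chi$ ranges over names and deposit variables; $v,w$ over non-negative rationals. Static expressions $\mathcal E$ are built from integer constants and integer variables with the usual arithmetic operators; a closed one evaluates to an integer $[\![\mathcal E]\!]$. A vector $\vec{\cdot}$ is a finite sequence. *Preconditions:* $G ::= P{:}v@\chi \mid P{:}\mathtt{secret}\,a\ (a\in S_P) \mid (G\,|\,G)$, with the $\chi$'s in $G$ distinct. *Contracts:* $C ::= \sum_{i\in I} D_i$ ($I$ finite; $0$ is the empty sum). *Guarded contracts:* $D ::= \mathtt{withdraw}\,P \mid \mathtt{reveal}\,\vec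 a\ \mathtt{if}\ p\,.\,C \mid \mathtt{split}\,\|_{i}(w_i\to C_i) \mid P{:}D \mid \mathtt{after}\ \mathcal E{:}D \mid {*}{:}\mathtt{rngt}\ \mathsf X\langle\vec{\mathcal E}\rangle$. Predicates: $p ::= \mathit{true}\mid p\wedge p\mid \neg p\mid E=E\mid E<E$, with $E ::= \mathcal E\mid a\mid E+E\mid E-E$. In $\mathtt{reveal}\,\vec a\ \mathtt{if}\ p$ the names $\vec a$ are distinct and include those in $p$. In every $\mathtt{split}$ the (finitely many) weights have positive sum. Each $\mathsf X$ has a unique defining equation $\mathsf X(\vec\beta)=\{G\}C$, and uses of $\mathsf X$ have the right number of arguments. The order of decorations $P{:}$, $\mathtt{after}\ \mathcal E{:}$ is immaterial, and repeated decorations by the same participant are identified. Contracts in configurations have no free integer variables; closed static expressions in them are identified with their values. *Advertisements* $\{G\}^{\circ}C$, with $\circ$ empty or a name, satisfy: each secret name in $C$ occurs in $G$; $G$ requires a deposit from each participant in the advertisement; each ${*}{:}\mathtt{rngt}\,\mathsf X\langle\vec{\mathcal E}\rangle$ in $C$ refers to a defining equation $\mathsf X(\vec\beta)=\{G'\}C'$ where $G'$ has the same participants as $G$. *Configurations* are parallel compositions ($|$ with unit $0$, a commutative monoid) of: advertisements $\{G\}^\circ C$; active contracts $\langle C,v\rangle_x$; deposits $\langle P,v\rangle_x$; authorizations $P[\xi]$; committed secrets $\{P{:}a\#N\}$ ($N\in\mathbb N\cup\{\bot\}$); revealed secrets $P{:}a\#N$ ($N\in\mathbb N$); bindings $P{:}d\leftarrow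 x$; a time term $t$ (natural number, at most one occurrence). There are no duplicate authorizations, and distinct active contracts have distinct names. Here $\xi$ is one of: $\#\rhd\{G\}^\circ C$; $x\rhd\{G\}^\circ C$; $x\rhd D$; $x,y\rhd\langle P,v\rangle$; $x\rhd\langle P,v\rangle,\langle P,v'\rangle$; $x\rhd Q$; $\vec x,i\rhd y$. $\mathrm{cn}(\Gamma)$ is the set of $x$ such that $\Gamma$ contains some $\langle C,v\rangle_x$. A configuration is *timed* if it contains a time term; an *initial* configuration consists of deposits only (together with a time term). "Fresh" means distinct from all names occurring in the configurations (concrete and abstract) and runs under consideration (when an abstract run mirrors a given concrete run, the same fresh names may be chosen in both); fresh secret names for $P$ are chosen in $S_P$. **Concrete semantics** $\Gamma\xrightarrow{\ell}_\flat\Gamma'$ between timed configurations (in the rules, $\Gamma$ is an arbitrary remaining part, possibly including $t$; the label is given in brackets): - Deposits. $\langle P,v\rangle_x|\langle P,v'\rangle_y|\Gamma$ adds $P[x,y\rhd\langle P,v+v'\rangle]$ [$P{:}x,y$]; with both $P[x,y\rhd\langle P,v+v'\rangle]$ and $P[y,x\rhd\langle P,v+v'\rangle]$ present, the two deposits and these authorizations are replaced by $\langle P,v+v'\rangle_z$, $z$ fresh [$\mathit{join}(x,y)$]. $\langle P,v+v'\rangle_x$ allows adding $P[x\rhd\langle P,v\rangle,\langle P,v'\rangle]$ [$P{:}x,v,v'$]; with it, deposit and authorization are replaced by $\langle P,v\rangle_y|\langle P,v'\rangle_{y'}$, $y,y'$ fresh [$\mathit{divide}(x,v,v')$]. $\langle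 P,v\rangle_x$ allows adding $P[x\rhd Q]$ [$P{:}x,Q$]; with it, both are replaced by $\langle Q,v\rangle_y$, $y$ fresh [$\mathit{donate}(x,Q)$]. Given $\|_{i=1}^n\langle P_i,v_i\rangle_{x_i}$, $\vec x=x_1\cdots x_n$, one can add $P_j[\vec x,j\rhd y]$, $y$ fresh except in destroy authorizations for $\vec x$ [$P_j{:}\vec x,j$]; when $P_i[\vec x,i\rhd y]$ are present for all $i$, all these deposits and authorizations are removed [$\mathit{destroy}(\vec x)$]. - C-Adv: if for each $P{:}v@x$ in $G$ ($x$ a name) $\langle P,v\rangle_x$ is in $\Gamma$, and all secrets in $G$ are fresh, then $\Gamma\to\{G\}C|\Gamma$ [$\mathit{adv}(\{G\}C)$]. - C-AuthCommit: $\{G\}^\circ C|\Gamma\to\{G\}^\circ C|\Gamma|\Delta_s|\Delta_d|P[\#\rhd\{G\}^\circ C]$ [$P{:}\{G\}^\circ C,\Delta_s|\Delta_d$], where $\Delta_s=\|_{i=1}^k\{P{:}a_i\#N_i\}$ for $a_1,\dots,a_k$ all the secrets of $P$ in $G$, none of which already occurs committed or revealed in $\Gamma$, with $N_i\in\mathbb N$ if $P\in\mathrm{Hon}$ and $N_i\in\mathbb N\cup\{\bot\}$ otherwise; $\Delta_d=\|_{i=1}^h P{:}d_i\leftarrow x_i$ for $d_1,\dots,d_h$ all the deposit variables of $P$ in $G$ (with $P{:}v_i@d_i$ in $G$), with no binding of $P$ for $d_i$ in $\Gamma$, $\langle P,v_i\rangle_{x_i}$ in $\Gamma$, the $x_i$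 pairwise distinct and different from every name $x$ with $P{:}v@x$ in $G$. - C-AuthInitDep: if $Q[\#\rhd\{G\}^\circ C]$ is in $\Gamma$ for all $Q$ in $G$, and either $P{:}v@\chi$ is in $G$ with $\chi=x$ or ($\chi=d$ and $P{:}d\leftarrow x$ in $\Gamma$), or $\circ=x$ and $P$ occurs in $G$, then $\{G\}^\circ C|\Gamma\to\{G\}^\circ C|\Gamma|P[x\rhd\{G\}^\circ C]$ [$P{:}\{G\}^\circ C,x$]. - C-Init: let $G=(\|_{i\in I}P_i{:}v_i@x_i)|(\|_{i\in J}Q_i{:}v'_i@d_i)|(\|_{i\in K}R_i{:}\mathtt{secret}\,a_i)$, and let $\Delta$ consist of $\langle P_i,v_i\rangle_{x_i}$ and $P_i[x_i\rhd\{G\}C]$ ($i\in I$), of $\langle Q_i,v'_i\rangle_{x'_i}$, $Q_i{:}d_i\leftarrow x'_i$ and $Q_i[x'_i\rhd\{G\}C]$ ($i\in J$), and of $P[\#\rhd\{G\}C]$ for all $P$ in $G$. Then $\{G\}C|\Delta|\Gamma\to\langle C,\sum_I v_i+\sum_J v'_i\rangle_z|\Gamma$, $z$ fresh [$\mathit{init}(G,C)$]. - C-Withdraw: $\langle\mathtt{withdraw}\,P,v\rangle_x|\Gamma\to\langle P,v\rangle_y|\Gamma$, $y$ fresh [$\mathit{withdraw}(P,v,x)$]. - C-Split: $\langle\mathtt{split}\,\|_{i=1}^k(w_i\to C_i),v\rangle_x|\Gamma\to\|_{i=1}^k\langle C_i,v w_i/\sum_j w_j\rangle_{y_i}|\Gamma$,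 $y_i$ fresh and distinct [$\mathit{split}(x)$]. - C-AuthRev: $\{P{:}a\#N\}|\Gamma\to P{:}a\#N|\Gamma$ if $N\ne\bot$ [$P{:}a$]. - C-Rev: if $\Delta=\|_{i=1}^n Q_i{:}a_i\#N_i$, $\vec a=a_1\cdots a_n$, and $p$ is true when each $a_i$ is evaluated as $N_i$, then $\langle\mathtt{reveal}\,\vec a\ \mathtt{if}\ p.C,v\rangle_x|\Gamma|\Delta\to\langle C,v\rangle_y|\Gamma|\Delta$, $y$ fresh [$\mathit{rev}(\vec a,y)$]. - C-AuthBranch: $\langle P{:}D+C,v\rangle_x|\Gamma\to\langle P{:}D+C,v\rangle_x|P[x\rhd P{:}D]|\Gamma$ [$P{:}(x,P{:}D)$]. - C-Branch: if $D=P_1{:}\cdots P_k{:}\mathtt{after}\ t_1{:}\cdots\mathtt{after}\ t_m{:}D'$ ($k,m\ge0$), $D'$ has no top-level decoration, $\langle D',v\rangle_x|\Gamma\xrightarrow{\ell}_\flat\Gamma'$ with $x\notin\mathrm{cn}(\Gamma')$, and $t\ge t_1,\dots,t_m$, then $\langle D+C,v\rangle_x|\,\|_{i=1}^kP_i[x\rhd D]\,|\Gamma|t\xrightarrow{\ell}_\flat\Gamma'|t$. - C-Delay: $\Gamma|t\to\Gamma|t+\delta$ for $\delta>0$ [$\delta$]. - Write $\{G\}C\equiv\mathsf X\langle\vec{\mathcal E}\rangle$ if $\{G\}C$ is $\alpha$-equivalent (w.r.t. secret names and deposit variables) to the advertisement obtained from the defining equation $\mathsf X(\vec\beta)=\{G'\}C'$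 by replacing $\vec\beta$ with $[\![\vec{\mathcal E}]\!]$ and evaluating the static expressions. C-AdvRngt: if $\{G\}C\equiv\mathsf X\langle\vec{\mathcal E}\rangle$, the secrets and deposit variables of $G$ are fresh, no $\{G'\}^xC'$ in $\Gamma$ has $\{G'\}C'\equiv\mathsf X\langle\vec{\mathcal E}\rangle$, and each $P{:}v@y$ in $G$ with $y$ a name has $\langle P,v\rangle_y$ in $\Gamma$, then $\langle{*}{:}\mathtt{rngt}\,\mathsf X\langle\vec{\mathcal E}\rangle+C_{alt},v\rangle_x|\Gamma$ adds $\{G\}^xC$ [$\mathit{advRngt}(\{G\}^xC)$]. - C-Rngt: if $\{G\}C\equiv\mathsf X\langle\vec{\mathcal E}\rangle$, with $G$ and $\Delta$ as in C-Init but with $\{G\}^xC$ in place of $\{G\}C$ in authorizations and $\Delta$ additionally containing $P[x\rhd\{G\}^xC]$ for all $P$ in $G$, then $\langle{*}{:}\mathtt{rngt}\,\mathsf X\langle\vec{\mathcal E}\rangle+C_{alt},v\rangle_x|\{G\}^xC|\Gamma|\Delta\to\langle C,v+\sum_Iv_i+\sum_Jv'_i\rangle_y|\Gamma$, $y$ fresh [$\mathit{rngt}(x,G,C)$]. **Abstraction.** For a participant $A$: $\alpha_A(\sum_iD_i)=\sum_i\alpha_A(D_i)$; $\alpha_A(\mathtt{withdraw}\,P)=\mathtt{withdraw}\,P$; $\alpha_A(\mathtt{reveal}\,\vec a\ \mathtt{if}\ p.C)$ is $\tau.\alpha_A(C)$ if $p=\mathit{true}$ and $\vec a\subseteq S_A$,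 and ${*}{:}\tau.\alpha_A(C)$ otherwise; $\alpha_A(\mathtt{split}\,\|_i(w_i\to C_i))=\mathtt{split}\,\|_i(\to\alpha_A(C_i))$; $\alpha_A(P{:}D)$ is $\alpha_A(D)$ if $P=A$ and ${*}{:}\alpha_A(D)$ otherwise; $\alpha_A(\mathtt{after}\ t{:}D)=\alpha_A(D)$; $\alpha_A({*}{:}\mathtt{rngt}\,\mathsf X\langle\vec{\mathcal E}\rangle)={*}{:}\mathtt{rngt}\,\mathsf X$. Each $\mathsf X(\vec\beta)=\{G\}C$ is abstracted as $\mathsf X=_\sharp\alpha_A(C)$. For a set $\mathcal X$ of names: $\alpha_{A,\mathcal X}(\Delta|\Delta')=\alpha_{A,\mathcal X}(\Delta)|\alpha_{A,\mathcal X}(\Delta')$; $\alpha_{A,\mathcal X}(\langle C,v\rangle_x)=\langle\alpha_A(C)\rangle_x$ if $x\in\mathcal X$; every other single term is mapped to $0$. Abstract configurations are parallel compositions of terms $\langle C\rangle_x$ ($C$ an abstract contract) and recursion variables $\mathsf X$; $\mathrm{cn}$ is the set of $x$ of its terms $\langle C\rangle_x$. ${*}{:}{*}{:}D$ is identified with ${*}{:}D$. **Abstract semantics** $\xrightarrow{\ell}_\sharp$, with labels $x$ or ${*}{:}x$ (${*}{:}{*}{:}\ell$ identified with ${*}{:}\ell$; $\mathrm{cn}(x)=\mathrm{cn}({*}{:}x)=\{x\}$): $\langle\mathtt{withdraw}\,P\rangle_x|\Gamma\xrightarrow{x}_\sharp\Gamma$; $\langle\tau.C\rangle_x|\Gamma\xrightarrow{x}_\sharp\langle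 C\rangle_y|\Gamma$, $y$ fresh; $\langle\mathtt{split}\,\|_i(\to C_i)\rangle_x|\Gamma\xrightarrow{x}_\sharp\|_i\langle C_i\rangle_{y_i}|\Gamma$, $y_i$ fresh and distinct; if $\langle D\rangle_x|\Gamma\xrightarrow{\ell}_\sharp\Gamma'$ and $x\in\mathrm{cn}(\ell)$ then $\langle D+C\rangle_x|\Gamma\xrightarrow{\ell}_\sharp\Gamma'$ and $\langle{*}{:}D\rangle_x|\Gamma\xrightarrow{{*}:\ell}_\sharp\Gamma'$; if $\mathsf X=_\sharp C$ then $\langle{*}{:}\mathtt{rngt}\,\mathsf X\rangle_x|\Gamma\xrightarrow{{*}:x}_\sharp\langle C\rangle_y|\mathsf X|\Gamma$, $y$ fresh. **Origin and descendants.** For a run $\mathcal R$ from $\Gamma$, the partial function $\mathrm{orig}_\Gamma$ is: $\mathrm{orig}_\Gamma(\Gamma,x)=x$ if $x\in\mathrm{cn}(\Gamma)$; and, if $\Gamma_{\mathcal R}$ is the last configuration of $\mathcal R$, $\mathrm{orig}_\Gamma(\mathcal R\xrightarrow{\ell}\Gamma',x)$ equals $\mathrm{orig}_\Gamma(\mathcal R,x)$ if $x\in\mathrm{cn}(\Gamma_{\mathcal R})\cap\mathrm{cn}(\Gamma')$, and equals $\mathrm{orig}_\Gamma(\mathcal R,y)$ if $x\in\mathrm{cn}(\Gamma')\setminus\mathrm{cn}(\Gamma_{\mathcal R})$ and $\{y\}=\mathrm{cn}(\Gamma_{\mathcal R})\setminus\mathrm{cn}(\Gamma')$; undefined otherwise.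 For $\mathcal R=\Gamma\to_\flat^*\Gamma'$ and a set of names $\mathcal X$, $\mathrm{desc}_\Gamma(\mathcal R,\mathcal X)=\{x\in\mathrm{cn}(\Gamma')\mid\mathrm{orig}_\Gamma(\mathcal R,x)\in\mathcal X\}$. *)

theory Defs
  imports Complex_Main "HOL-Library.Multiset" "HOL-Library.FSet"
begin

(*
  Type variables: 'p participants, 'n names (of deposits and contracts), 'd deposit variables,
  'a secret names, 'x recursion variables, 'b integer variables.

  Contracts are parametric in the type 'e of static expressions.  Defining equations use
  'e = 'b sexp; contracts in configurations use 'e = int, so that they have no free integer
  variables and closed static expressions are identified with their values.
*)

section \<open>Syntax\<close>

datatype aop = OpPlus | OpMinus | OpTimes | OpDiv | OpMod

datatype (svars: 'b) sexp = SConst int | SVar 'b | SOp aop "'b sexp" "'b sexp"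

(* Division is total with the conventions of HOL: k div 0 = 0 and k mod 0 = k. *)
fun aop_fun :: "aop \<Rightarrow> int \<Rightarrow> int \<Rightarrow> int" where
  "aop_fun OpPlus j k = j + k"
| "aop_fun OpMinus j k = j - k"
| "aop_fun OpTimes j k = j * k"
| "aop_fun OpDiv j k = j div k"
| "aop_fun OpMod j k = j mod k"

primrec seval :: "('b \<Rightarrow> int) \<Rightarrow> 'b sexp \<Rightarrow> int" where
  "seval \<eta> (SConst k) = k"
| "seval \<eta> (SVar \<beta>) = \<eta> \<beta>"
| "seval \<eta> (SOp f s s') = aop_fun f (seval \<eta> s) (seval \<eta> s')"

datatype ('n, 'd) depref = Name 'n | DVar 'd

datatype (pre_participant: 'p, pre_names: 'n, pre_dvars: 'd, pre_secrets: 'a) pre =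
    Deposit 'p rat "('n, 'd) depref"
  | Secret 'p 'a

type_synonym ('p, 'n, 'd, 'a) precond = "('p, 'n, 'd, 'a) pre multiset"

datatype ('a, 'e) rexp =
    RStat 'e
  | RSec 'a
  | RPlus "('a, 'e) rexp" "('a, 'e) rexp"
  | RMinus "('a, 'e) rexp" "('a, 'e) rexp"

datatype (prd_secrets: 'a, prd_exprs: 'e) prd =
    PTrue
  | PAnd "('a, 'e) prd" "('a, 'e) prd"
  | PNot "('a, 'e) prd"
  | PEq "('a, 'e) rexp" "('a, 'e) rexp"
  | PLess "('a, 'e) rexp" "('a, 'e) rexp"

(*
  Guard Ps ts D is P1: ... Pk: after t1: ... after tm: D where Ps = {P1,...,Pk}, ts = {t1,...,tm}
  and D has no top-level decoration: the order of decorations is immaterial, and repeated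
  decorations by the same participant are identified.
  Rngt X es stands for *:rngt X<es>.
*)
datatype (c_participants: 'p, c_secrets: 'a, c_recvars: 'x, c_exprs: 'e) contract =
    Sum "('p, 'a, 'x, 'e) guarded multiset"
and (g_participants: 'p, g_secrets: 'a, g_recvars: 'x, g_exprs: 'e) guarded =
    Guard "'p fset" "'e multiset" "('p, 'a, 'x, 'e) action"
and (d_participants: 'p, d_secrets: 'a, d_recvars: 'x, d_exprs: 'e) action =
    Withdraw 'p
  | Reveal "'a list" "('a, 'e) prd" "('p, 'a, 'x, 'e) contract"
  | Split "(rat \<times> ('p, 'a, 'x, 'e) contract) list"
  | Rngt 'x "'e list"

abbreviation single :: "('p, 'a, 'x, 'e) action \<Rightarrow> ('p, 'a, 'x, 'e) contract" where
  "single D \<equiv> Sum {#Guard {||} {#} D#}"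

(* eqn M X = (\<beta>s, G, C) encodes the unique defining equation X(\<beta>s) = {G}C. *)
record ('p, 'n, 'd, 'a, 'x, 'b) bitml =
  honest :: "'p set"
  secret_names :: "'p \<Rightarrow> 'a set"
  eqn :: "'x \<Rightarrow> 'b list \<times> ('p, 'n, 'd, 'a) precond \<times> ('p, 'a, 'x, 'b sexp) contract"

definition eqn_params :: "('p, 'n, 'd, 'a, 'x, 'b) bitml \<Rightarrow> 'x \<Rightarrow> 'b list" where
  "eqn_params M X = fst (eqn M X)"

definition eqn_pre :: "('p, 'n, 'd, 'a, 'x, 'b) bitml \<Rightarrow> 'x \<Rightarrow> ('p, 'n, 'd, 'a) precond" where
  "eqn_pre M X = fst (snd (eqn M X))"

definition eqn_body ::
  "('p, 'n, 'd, 'a, 'x, 'b) bitml \<Rightarrow> 'x \<Rightarrow> ('p, 'a, 'x, 'b sexp) contract" where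
  "eqn_body M X = snd (snd (eqn M X))"

definition participants_of :: "('p, 'n, 'd, 'a) precond \<Rightarrow> 'p set" where
  "participants_of G = (\<Union>g\<in>set_mset G. pre_participant g)"

definition secrets_of :: "('p, 'n, 'd, 'a) precond \<Rightarrow> 'a set" where
  "secrets_of G = (\<Union>g\<in>set_mset G. pre_secrets g)"

definition dvars_of :: "('p, 'n, 'd, 'a) precond \<Rightarrow> 'd set" where
  "dvars_of G = (\<Union>g\<in>set_mset G. pre_dvars g)"

inductive wf_contract :: "('p, 'n, 'd, 'a, 'x, 'b) bitml \<Rightarrow> ('p, 'a, 'x, 'e) contract \<Rightarrow> bool"
  and wf_guarded :: "('p, 'n, 'd, 'a, 'x, 'b) bitml \<Rightarrow> ('p, 'a, 'x, 'e) guarded \<Rightarrow> bool"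
  and wf_action :: "('p, 'n, 'd, 'a, 'x, 'b) bitml \<Rightarrow> ('p, 'a, 'x, 'e) action \<Rightarrow> bool"
  for M :: "('p, 'n, 'd, 'a, 'x, 'b) bitml"
where
  wf_Sum: "(\<And>D. D \<in># Ds \<Longrightarrow> wf_guarded M D) \<Longrightarrow> wf_contract M (Sum Ds)"
| wf_Guard: "wf_action M D \<Longrightarrow> wf_guarded M (Guard Ps ts D)"
| wf_Withdraw: "wf_action M (Withdraw P)"
| wf_Reveal: "\<lbrakk>distinct as; prd_secrets p \<subseteq> set as; wf_contract M C\<rbrakk>
    \<Longrightarrow> wf_action M (Reveal as p C)"
| wf_Split: "\<lbrakk>\<And>w C. (w, C) \<in> set ws \<Longrightarrow> w \<ge> 0 \<and> wf_contract M C; sum_list (map fst ws) > 0\<rbrakk>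
    \<Longrightarrow> wf_action M (Split ws)"
| wf_Rngt: "length es = length (eqn_params M X) \<Longrightarrow> wf_action M (Rngt X es)"

definition wf_pre :: "('p, 'n, 'd, 'a, 'x, 'b) bitml \<Rightarrow> ('p, 'n, 'd, 'a) precond \<Rightarrow> bool" where
  "wf_pre M G \<longleftrightarrow>
     G \<noteq> {#} \<and>
     (\<forall>P v \<chi>. Deposit P v \<chi> \<in># G \<longrightarrow> v \<ge> 0) \<and>
     (\<forall>P a. Secret P a \<in># G \<longrightarrow> a \<in> secret_names M P) \<and>
     (\<forall>\<chi>. size {#g \<in># G. \<exists>P v. g = Deposit P v \<chi>#} \<le> 1)"

definition wf_adv ::
  "('p, 'n, 'd, 'a, 'x, 'b) bitml \<Rightarrow> ('p, 'n, 'd, 'a) precond \<Rightarrow> ('p, 'a, 'x, 'e) contract \<Rightarrow> bool"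
where
  "wf_adv M G C \<longleftrightarrow>
     wf_pre M G \<and> wf_contract M C \<and>
     c_secrets C \<subseteq> secrets_of G \<and>
     (\<forall>P \<in> participants_of G \<union> c_participants C. \<exists>v \<chi>. Deposit P v \<chi> \<in># G) \<and>
     (\<forall>X \<in> c_recvars C. participants_of (eqn_pre M X) = participants_of G)"

definition bitml_setting :: "('p, 'n, 'd, 'a, 'x, 'b) bitml \<Rightarrow> bool" where
  "bitml_setting M \<longleftrightarrow>
     infinite (UNIV :: 'n set) \<and>
     finite (UNIV :: 'x set) \<and>
     (\<forall>P Q. P \<noteq> Q \<longrightarrow> secret_names M P \<inter> secret_names M Q = {}) \<and>
     (\<forall>X. wf_adv M (eqn_pre M X) (eqn_body M X))"

section \<open>Configurations\<close>

(* Adv G None C is {G}C, and Adv G (Some x) C is {G}^x C. *)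
datatype ('p, 'n, 'd, 'a, 'x) adv =
  Adv "('p, 'n, 'd, 'a) precond" "'n option" "('p, 'a, 'x, int) contract"

datatype ('p, 'n, 'd, 'a, 'x) auth =
    ACommit "('p, 'n, 'd, 'a, 'x) adv"            (* # \<rhd> {G}C *)
  | ASpend 'n "('p, 'n, 'd, 'a, 'x) adv"          (* x \<rhd> {G}C *)
  | ABranch 'n "('p, 'a, 'x, int) guarded"        (* x \<rhd> D *)
  | AJoin 'n 'n 'p rat                            (* x, y \<rhd> <P, v> *)
  | ADivide 'n 'p rat rat                         (* x \<rhd> <P, v>, <P, v'> *)
  | ADonate 'n 'p                                 (* x \<rhd> Q *)
  | ADestroy "'n list" nat 'n                     (* xs, i \<rhd> y, with i counted from 1 *)

datatype (t_participants: 'p, t_names: 'n, t_dvars: 'd, t_secrets: 'a, t_recvars: 'x) cterm =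
    TAdv "('p, 'n, 'd, 'a, 'x) adv"
  | TContract "('p, 'a, 'x, int) contract" rat 'n
  | TDep 'p rat 'n
  | TAuth 'p "('p, 'n, 'd, 'a, 'x) auth"
  | TCommit 'p 'a "nat option"                    (* {P:a#N}, with None for N = bottom *)
  | TReveal 'p 'a nat
  | TBind 'p 'd 'n
  | TTime nat

type_synonym ('p, 'n, 'd, 'a, 'x) config = "('p, 'n, 'd, 'a, 'x) cterm multiset"

definition cn :: "('p, 'n, 'd, 'a, 'x) config \<Rightarrow> 'n set" where
  "cn \<Gamma> = {x. \<exists>C v. TContract C v x \<in># \<Gamma>}"

definition timed :: "('p, 'n, 'd, 'a, 'x) config \<Rightarrow> bool" where
  "timed \<Gamma> \<longleftrightarrow> (\<exists>t. TTime t \<in># \<Gamma>)"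

definition initial :: "('p, 'n, 'd, 'a, 'x) config \<Rightarrow> bool" where
  "initial \<Gamma> \<longleftrightarrow> (\<exists>t \<Delta>. \<Gamma> = add_mset (TTime t) \<Delta> \<and> (\<forall>T \<in># \<Delta>. \<exists>P v x. T = TDep P v x))"

fun wf_advert :: "('p, 'n, 'd, 'a, 'x, 'b) bitml \<Rightarrow> ('p, 'n, 'd, 'a, 'x) adv \<Rightarrow> bool" where
  "wf_advert M (Adv G o' C) \<longleftrightarrow> wf_adv M G C"

fun wf_auth :: "('p, 'n, 'd, 'a, 'x, 'b) bitml \<Rightarrow> ('p, 'n, 'd, 'a, 'x) auth \<Rightarrow> bool" where
  "wf_auth M (ACommit \<Phi>) \<longleftrightarrow> wf_advert M \<Phi>"
| "wf_auth M (ASpend x \<Phi>) \<longleftrightarrow> wf_advert M \<Phi>"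
| "wf_auth M (ABranch x D) \<longleftrightarrow> wf_guarded M D"
| "wf_auth M (AJoin x y P v) \<longleftrightarrow> v \<ge> 0"
| "wf_auth M (ADivide x P v v') \<longleftrightarrow> v \<ge> 0 \<and> v' \<ge> 0"
| "wf_auth M (ADonate x Q) \<longleftrightarrow> True"
| "wf_auth M (ADestroy xs i y) \<longleftrightarrow> True"

fun wf_term :: "('p, 'n, 'd, 'a, 'x, 'b) bitml \<Rightarrow> ('p, 'n, 'd, 'a, 'x) cterm \<Rightarrow> bool" where
  "wf_term M (TAdv \<Phi>) \<longleftrightarrow> wf_advert M \<Phi>"
| "wf_term M (TContract C v x) \<longleftrightarrow> wf_contract M C \<and> v \<ge> 0"
| "wf_term M (TDep P v x) \<longleftrightarrow> v \<ge> 0"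
| "wf_term M (TAuth P \<xi>) \<longleftrightarrow> wf_auth M \<xi>"
| "wf_term M (TCommit P a N) \<longleftrightarrow> True"
| "wf_term M (TReveal P a N) \<longleftrightarrow> True"
| "wf_term M (TBind P d x) \<longleftrightarrow> True"
| "wf_term M (TTime t) \<longleftrightarrow> True"

definition valid :: "('p, 'n, 'd, 'a, 'x, 'b) bitml \<Rightarrow> ('p, 'n, 'd, 'a, 'x) config \<Rightarrow> bool" where
  "valid M \<Gamma> \<longleftrightarrow>
     (\<forall>T \<in># \<Gamma>. wf_term M T) \<and>
     (\<forall>P \<xi>. count \<Gamma> (TAuth P \<xi>) \<le> 1) \<and>
     (\<forall>x. size {#T \<in># \<Gamma>. \<exists>C v. T = TContract C v x#} \<le> 1) \<and>
     size {#T \<in># \<Gamma>. \<exists>t. T = TTime t#} \<le> 1"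

section \<open>Concrete semantics\<close>

datatype ('p, 'n, 'd, 'a, 'x) label =
    LAuthJoin 'p 'n 'n
  | LJoin 'n 'n
  | LAuthDivide 'p 'n rat rat
  | LDivide 'n rat rat
  | LAuthDonate 'p 'n 'p
  | LDonate 'n 'p
  | LAuthDestroy 'p "'n list" nat
  | LDestroy "'n list"
  | LAdv "('p, 'n, 'd, 'a, 'x) adv"
  | LAuthCommit 'p "('p, 'n, 'd, 'a, 'x) adv" "('p, 'n, 'd, 'a, 'x) config"
  | LAuthInitDep 'p "('p, 'n, 'd, 'a, 'x) adv" 'n
  | LInit "('p, 'n, 'd, 'a) precond" "('p, 'a, 'x, int) contract"
  | LWithdraw 'p rat 'n
  | LSplit 'n
  | LAuthRev 'p 'a
  | LRev "'a list" 'n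
  | LAuthBranch 'p 'n "('p, 'a, 'x, int) guarded"
  | LDelay nat
  | LAdvRngt "('p, 'n, 'd, 'a, 'x) adv"
  | LRngt 'n "('p, 'n, 'd, 'a) precond" "('p, 'a, 'x, int) contract"

primrec reval :: "('a \<Rightarrow> nat) \<Rightarrow> ('a, int) rexp \<Rightarrow> int" where
  "reval N (RStat k) = k"
| "reval N (RSec a) = int (N a)"
| "reval N (RPlus E E') = reval N E + reval N E'"
| "reval N (RMinus E E') = reval N E - reval N E'"

primrec peval :: "('a \<Rightarrow> nat) \<Rightarrow> ('a, int) prd \<Rightarrow> bool" where
  "peval N PTrue \<longleftrightarrow> True"
| "peval N (PAnd p q) \<longleftrightarrow> peval N p \<and> peval N q"
| "peval N (PNot p) \<longleftrightarrow> \<not> peval N p"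
| "peval N (PEq E E') \<longleftrightarrow> reval N E = reval N E'"
| "peval N (PLess E E') \<longleftrightarrow> reval N E < reval N E'"

definition names_in :: "('p, 'n, 'd, 'a, 'x) config set \<Rightarrow> 'n set" where
  "names_in U = (\<Union>\<Gamma>\<in>U. \<Union>T\<in>set_mset \<Gamma>. t_names T)"

definition secrets_in :: "('p, 'n, 'd, 'a, 'x) config set \<Rightarrow> 'a set" where
  "secrets_in U = (\<Union>\<Gamma>\<in>U. \<Union>T\<in>set_mset \<Gamma>. t_secrets T)"

definition dvars_in :: "('p, 'n, 'd, 'a, 'x) config set \<Rightarrow> 'd set" where
  "dvars_in U = (\<Union>\<Gamma>\<in>U. \<Union>T\<in>set_mset \<Gamma>. t_dvars T)"

(*
  rngt_equiv M X ks G C is {G}C \<equiv> X<ks>.  All secret names and deposit variables of an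
  advertisement are bound by its precondition, so \<alpha>-equivalence is an injective renaming
  \<rho> of secret names together with an injective renaming \<sigma> of deposit variables.  An equation
  whose body has integer variables other than its parameters has no closed instance.
*)
definition rngt_equiv ::
  "('p, 'n, 'd, 'a, 'x, 'b) bitml \<Rightarrow> 'x \<Rightarrow> int list \<Rightarrow>
   ('p, 'n, 'd, 'a) precond \<Rightarrow> ('p, 'a, 'x, int) contract \<Rightarrow> bool" where
  "rngt_equiv M X ks G C \<longleftrightarrow>
     (let \<beta>s = eqn_params M X; G' = eqn_pre M X; C' = eqn_body M X;
          \<eta> = (\<lambda>\<beta>. the (map_of (zip \<beta>s ks) \<beta>)) in
      length ks = length \<beta>s \<and>
      (\<Union>e\<in>c_exprs C'. svars e) \<subseteq> set \<beta>s \<and>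
      (\<exists>\<rho> \<sigma>. inj_on \<rho> (secrets_of G' \<union> c_secrets C') \<and> inj_on \<sigma> (dvars_of G') \<and>
             G = image_mset (map_pre id id \<sigma> \<rho>) G' \<and>
             C = map_contract id \<rho> id (seval \<eta>) C'))"

definition pre_value :: "('p, 'n, 'd, 'a) precond \<Rightarrow> rat" where
  "pre_value G = (\<Sum>g\<in>#G. case g of Deposit P v \<chi> \<Rightarrow> v | Secret P a \<Rightarrow> 0)"

(* The part \<Delta> consumed when the advertisement {G}C or {G}^x C is stipulated, b being the names
   bound to the deposit variables. *)
definition stipulation ::
  "('p, 'n, 'd, 'a) precond \<Rightarrow> ('p, 'n, 'd, 'a, 'x) adv \<Rightarrow> ('d \<Rightarrow> 'n) \<Rightarrow>
   ('p, 'n, 'd, 'a, 'x) config" where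
  "stipulation G \<Phi> b =
     (\<Sum>g\<in>#G. case g of
         Deposit P v (Name x) \<Rightarrow> {#TDep P v x, TAuth P (ASpend x \<Phi>)#}
       | Deposit P v (DVar d) \<Rightarrow> {#TDep P v (b d), TBind P d (b d), TAuth P (ASpend (b d) \<Phi>)#}
       | Secret P a \<Rightarrow> {#})
     + image_mset (\<lambda>P. TAuth P (ACommit \<Phi>)) (mset_set (participants_of G))"

(*
  cstep M U \<Gamma> l \<Gamma>' is \<Gamma> --l--> \<Gamma>', where U contains all configurations under consideration
  so far (\<Gamma> included): fresh names, secrets and deposit variables do not occur in U.
  The syntactic constraints on configurations are imposed on runs, see crun.
*)
inductive cstep ::
  "('p, 'n, 'd, 'a, 'x, 'b) bitml \<Rightarrow> ('p, 'n, 'd, 'a, 'x) config set \<Rightarrow>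
   ('p, 'n, 'd, 'a, 'x) config \<Rightarrow> ('p, 'n, 'd, 'a, 'x) label \<Rightarrow> ('p, 'n, 'd, 'a, 'x) config \<Rightarrow> bool"
  for M :: "('p, 'n, 'd, 'a, 'x, 'b) bitml" and U :: "('p, 'n, 'd, 'a, 'x) config set"
where
  AuthJoin:
  "cstep M U ({#TDep P v x, TDep P v' y#} + \<Gamma>) (LAuthJoin P x y)
     ({#TDep P v x, TDep P v' y, TAuth P (AJoin x y P (v + v'))#} + \<Gamma>)"
| Join:
  "z \<notin> names_in U \<Longrightarrow>
   cstep M U
     ({#TDep P v x, TDep P v' y, TAuth P (AJoin x y P (v + v')), TAuth P (AJoin y x P (v + v'))#} + \<Gamma>)
     (LJoin x y)
     ({#TDep P (v + v') z#} + \<Gamma>)"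
| AuthDivide:
  "cstep M U ({#TDep P (v + v') x#} + \<Gamma>) (LAuthDivide P x v v')
     ({#TDep P (v + v') x, TAuth P (ADivide x P v v')#} + \<Gamma>)"
| Divide:
  "\<lbrakk>y \<notin> names_in U; y' \<notin> names_in U; y \<noteq> y'\<rbrakk> \<Longrightarrow>
   cstep M U ({#TDep P (v + v') x, TAuth P (ADivide x P v v')#} + \<Gamma>) (LDivide x v v')
     ({#TDep P v y, TDep P v' y'#} + \<Gamma>)"
| AuthDonate:
  "cstep M U ({#TDep P v x#} + \<Gamma>) (LAuthDonate P x Q)
     ({#TDep P v x, TAuth P (ADonate x Q)#} + \<Gamma>)"
| Donate:
  "y \<notin> names_in U \<Longrightarrow>
   cstep M U ({#TDep P v x, TAuth P (ADonate x Q)#} + \<Gamma>) (LDonate x Q)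
     ({#TDep Q v y#} + \<Gamma>)"
| AuthDestroy:
  "\<lbrakk>\<Delta> = mset (map (\<lambda>(P, v, x). TDep P v x) ds); xs = map (\<lambda>(P, v, x). x) ds;
    1 \<le> j; j \<le> length ds; P = fst (ds ! (j - 1));
    \<forall>\<Gamma>' \<in> U. \<forall>T \<in># \<Gamma>'. y \<in> t_names T \<longrightarrow> (\<exists>Q i. T = TAuth Q (ADestroy xs i y))\<rbrakk> \<Longrightarrow>
   cstep M U (\<Delta> + \<Gamma>) (LAuthDestroy P xs j) (\<Delta> + {#TAuth P (ADestroy xs j y)#} + \<Gamma>)"
| Destroy:
  "\<lbrakk>\<Delta> = mset (map (\<lambda>(P, v, x). TDep P v x) ds); xs = map (\<lambda>(P, v, x). x) ds;
    \<Delta>' = mset (map (\<lambda>i. TAuth (fst (ds ! (i - 1))) (ADestroy xs i y)) [1..<Suc (length ds)])\<rbrakk> \<Longrightarrow>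
   cstep M U (\<Delta> + \<Delta>' + \<Gamma>) (LDestroy xs) \<Gamma>"
| C_Adv:
  "\<lbrakk>\<And>P v x. Deposit P v (Name x) \<in># G \<Longrightarrow> TDep P v x \<in># \<Gamma>;
    secrets_of G \<inter> secrets_in U = {}\<rbrakk> \<Longrightarrow>
   cstep M U \<Gamma> (LAdv (Adv G None C)) ({#TAdv (Adv G None C)#} + \<Gamma>)"
| C_AuthCommit:
  "\<lbrakk>\<Phi> = Adv G c C;
    as = {a. Secret P a \<in># G};
    \<And>a Q N'. a \<in> as \<Longrightarrow> TCommit Q a N' \<notin># \<Gamma>;
    \<And>a Q N'. a \<in> as \<Longrightarrow> TReveal Q a N' \<notin># \<Gamma>;
    \<And>a. a \<in> as \<Longrightarrow> P \<in> honest M \<Longrightarrow> N a \<noteq> None;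
    \<Delta>\<^sub>s = image_mset (\<lambda>a. TCommit P a (N a)) (mset_set as);
    ds = {d. \<exists>v. Deposit P v (DVar d) \<in># G};
    \<And>d y. d \<in> ds \<Longrightarrow> TBind P d y \<notin># \<Gamma>;
    \<And>d v. Deposit P v (DVar d) \<in># G \<Longrightarrow> TDep P v (b d) \<in># \<Gamma>;
    inj_on b ds;
    \<And>d v x. d \<in> ds \<Longrightarrow> Deposit P v (Name x) \<in># G \<Longrightarrow> b d \<noteq> x;
    \<Delta>\<^sub>d = image_mset (\<lambda>d. TBind P d (b d)) (mset_set ds)\<rbrakk> \<Longrightarrow>
   cstep M U ({#TAdv \<Phi>#} + \<Gamma>) (LAuthCommit P \<Phi> (\<Delta>\<^sub>s + \<Delta>\<^sub>d))
     ({#TAdv \<Phi>#} + \<Gamma> + \<Delta>\<^sub>s + \<Delta>\<^sub>d + {#TAuth P (ACommit \<Phi>)#})"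
| C_AuthInitDep:
  "\<lbrakk>\<Phi> = Adv G c C;
    \<And>Q. Q \<in> participants_of G \<Longrightarrow> TAuth Q (ACommit \<Phi>) \<in># \<Gamma>;
    (\<exists>v. Deposit P v (Name x) \<in># G) \<or>
    (\<exists>v d. Deposit P v (DVar d) \<in># G \<and> TBind P d x \<in># \<Gamma>) \<or>
    (c = Some x \<and> P \<in> participants_of G)\<rbrakk> \<Longrightarrow>
   cstep M U ({#TAdv \<Phi>#} + \<Gamma>) (LAuthInitDep P \<Phi> x)
     ({#TAdv \<Phi>#} + \<Gamma> + {#TAuth P (ASpend x \<Phi>)#})"
| C_Init:
  "\<lbrakk>\<Phi> = Adv G None C; \<Delta> = stipulation G \<Phi> b; z \<notin> names_in U\<rbrakk> \<Longrightarrow>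
   cstep M U ({#TAdv \<Phi>#} + \<Delta> + \<Gamma>) (LInit G C) ({#TContract C (pre_value G) z#} + \<Gamma>)"
| C_Withdraw:
  "y \<notin> names_in U \<Longrightarrow>
   cstep M U ({#TContract (single (Withdraw P)) v x#} + \<Gamma>) (LWithdraw P v x) ({#TDep P v y#} + \<Gamma>)"
| C_Split:
  "\<lbrakk>length ys = length ws; distinct ys; set ys \<inter> names_in U = {}\<rbrakk> \<Longrightarrow>
   cstep M U ({#TContract (single (Split ws)) v x#} + \<Gamma>) (LSplit x)
     (mset (map (\<lambda>((w, C), y). TContract C (v * w / sum_list (map fst ws)) y) (zip ws ys)) + \<Gamma>)"
| C_AuthRev:
  "cstep M U ({#TCommit P a (Some N)#} + \<Gamma>) (LAuthRev P a) ({#TReveal P a N#} + \<Gamma>)"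
| C_Rev:
  "\<lbrakk>\<Delta> = mset (map (\<lambda>a. TReveal (Q a) a (N a)) as); peval N p; y \<notin> names_in U\<rbrakk> \<Longrightarrow>
   cstep M U ({#TContract (single (Reveal as p C)) v x#} + \<Gamma> + \<Delta>) (LRev as y)
     ({#TContract C v y#} + \<Gamma> + \<Delta>)"
| C_AuthBranch:
  "\<lbrakk>D = Guard Ps ts D'; P |\<in>| Ps\<rbrakk> \<Longrightarrow>
   cstep M U ({#TContract (Sum (add_mset D Ds)) v x#} + \<Gamma>) (LAuthBranch P x D)
     ({#TContract (Sum (add_mset D Ds)) v x, TAuth P (ABranch x D)#} + \<Gamma>)"
| C_Branch:
  "\<lbrakk>D = Guard Ps ts D';
    cstep M U ({#TContract (single D') v x#} + \<Gamma>) l \<Gamma>';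
    x \<notin> cn \<Gamma>';
    \<And>k. k \<in># ts \<Longrightarrow> k \<le> int t\<rbrakk> \<Longrightarrow>
   cstep M U
     ({#TContract (Sum (add_mset D Ds)) v x#}
       + image_mset (\<lambda>P. TAuth P (ABranch x D)) (mset_set (fset Ps)) + \<Gamma> + {#TTime t#})
     l
     (\<Gamma>' + {#TTime t#})"
| C_Delay:
  "\<delta> > 0 \<Longrightarrow> cstep M U (\<Gamma> + {#TTime t#}) (LDelay \<delta>) (\<Gamma> + {#TTime (t + \<delta>)#})"
| C_AdvRngt:
  "\<lbrakk>rngt_equiv M X ks G C;
    secrets_of G \<inter> secrets_in U = {};
    dvars_of G \<inter> dvars_in U = {};
    \<And>G' C'. TAdv (Adv G' (Some x) C') \<in># \<Gamma> \<Longrightarrow> \<not> rngt_equiv M X ks G' C';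
    \<And>P v' y. Deposit P v' (Name y) \<in># G \<Longrightarrow> TDep P v' y \<in># \<Gamma>\<rbrakk> \<Longrightarrow>
   cstep M U
     ({#TContract (Sum (add_mset (Guard {||} {#} (Rngt X ks)) Ds)) v x#} + \<Gamma>)
     (LAdvRngt (Adv G (Some x) C))
     ({#TContract (Sum (add_mset (Guard {||} {#} (Rngt X ks)) Ds)) v x, TAdv (Adv G (Some x) C)#} + \<Gamma>)"
| C_Rngt:
  "\<lbrakk>rngt_equiv M X ks G C;
    \<Phi> = Adv G (Some x) C;
    \<Delta> = stipulation G \<Phi> b + image_mset (\<lambda>P. TAuth P (ASpend x \<Phi>)) (mset_set (participants_of G));
    y \<notin> names_in U\<rbrakk> \<Longrightarrow>
   cstep M U
     ({#TContract (Sum (add_mset (Guard {||} {#} (Rngt X ks)) Ds)) v x, TAdv \<Phi>#} + \<Gamma> + \<Delta>)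
     (LRngt x G C)
     ({#TContract C (v + pre_value G) y#} + \<Gamma>)"

section \<open>Runs, origin and descendants\<close>

datatype ('c, 'l) run = Start 'c | Extend "('c, 'l) run" 'l 'c

primrec run_first :: "('c, 'l) run \<Rightarrow> 'c" where
  "run_first (Start \<Gamma>) = \<Gamma>"
| "run_first (Extend R l \<Gamma>') = run_first R"

primrec run_last :: "('c, 'l) run \<Rightarrow> 'c" where
  "run_last (Start \<Gamma>) = \<Gamma>"
| "run_last (Extend R l \<Gamma>') = \<Gamma>'"

primrec run_configs :: "('c, 'l) run \<Rightarrow> 'c set" where
  "run_configs (Start \<Gamma>) = {\<Gamma>}"
| "run_configs (Extend R l \<Gamma>') = insert \<Gamma>' (run_configs R)"

(* U: further configurations under consideration, from which fresh names must be distinct, in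
   addition to the configurations of the run itself. *)
primrec crun ::
  "('p, 'n, 'd, 'a, 'x, 'b) bitml \<Rightarrow> ('p, 'n, 'd, 'a, 'x) config set \<Rightarrow>
   (('p, 'n, 'd, 'a, 'x) config, ('p, 'n, 'd, 'a, 'x) label) run \<Rightarrow> bool" where
  "crun M U (Start \<Gamma>) \<longleftrightarrow> valid M \<Gamma> \<and> timed \<Gamma>"
| "crun M U (Extend R l \<Gamma>') \<longleftrightarrow>
     crun M U R \<and> cstep M (U \<union> run_configs R) (run_last R) l \<Gamma>' \<and> valid M \<Gamma>' \<and> timed \<Gamma>'"

definition creachable ::
  "('p, 'n, 'd, 'a, 'x, 'b) bitml \<Rightarrow> ('p, 'n, 'd, 'a, 'x) config \<Rightarrow> bool" where
  "creachable M \<Gamma> \<longleftrightarrow> (\<exists>R. crun M {} R \<and> initial (run_first R) \<and> run_last R = \<Gamma>)"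

(* orig R is the partial function orig with respect to the first configuration of R. *)
primrec orig :: "(('p, 'n, 'd, 'a, 'x) config, 'l) run \<Rightarrow> 'n \<Rightarrow> 'n option" where
  "orig (Start \<Gamma>) x = (if x \<in> cn \<Gamma> then Some x else None)"
| "orig (Extend R l \<Gamma>') x =
     (if x \<in> cn (run_last R) \<inter> cn \<Gamma>' then orig R x
      else if x \<in> cn \<Gamma>' - cn (run_last R) \<and> is_singleton (cn (run_last R) - cn \<Gamma>')
        then orig R (the_elem (cn (run_last R) - cn \<Gamma>'))
      else None)"

definition desc :: "(('p, 'n, 'd, 'a, 'x) config, 'l) run \<Rightarrow> 'n set \<Rightarrow> 'n set" where
  "desc R \<X> = {x \<in> cn (run_last R). \<exists>y \<in> \<X>. orig R x = Some y}"

section \<open>Abstraction\<close>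

(* AAct False D is D, AAct True D is *:D, and ARngt X is *:rngt X; thus *:*:D is identified
   with *:D. *)
datatype ('p, 'x) acontract =
    ASum "('p, 'x) aguarded multiset"
and ('p, 'x) aguarded =
    AAct bool "('p, 'x) aaction"
  | ARngt 'x
and ('p, 'x) aaction =
    AWithdraw 'p
  | ATau "('p, 'x) acontract"
  | ASplit "('p, 'x) acontract list"

fun star :: "('p, 'x) aguarded \<Rightarrow> ('p, 'x) aguarded" where
  "star (AAct s D) = AAct True D"
| "star (ARngt X) = ARngt X"

primrec abs_contract ::
    "('p \<Rightarrow> 'a set) \<Rightarrow> 'p \<Rightarrow> ('p, 'a, 'x, 'e) contract \<Rightarrow> ('p, 'x) acontract"
  and abs_guarded ::
    "('p \<Rightarrow> 'a set) \<Rightarrow> 'p \<Rightarrow> ('p, 'a, 'x, 'e) guarded \<Rightarrow> ('p, 'x) aguarded"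
  and abs_action ::
    "('p \<Rightarrow> 'a set) \<Rightarrow> 'p \<Rightarrow> ('p, 'a, 'x, 'e) action \<Rightarrow> ('p, 'x) aguarded"
where
  "abs_contract S A (Sum Ds) = ASum (image_mset (abs_guarded S A) Ds)"
| "abs_guarded S A (Guard Ps ts D) =
     (if \<exists>P. P |\<in>| Ps \<and> P \<noteq> A then star (abs_action S A D) else abs_action S A D)"
| "abs_action S A (Withdraw P) = AAct False (AWithdraw P)"
| "abs_action S A (Reveal as p C) =
     (if p = PTrue \<and> set as \<subseteq> S A then AAct False (ATau (abs_contract S A C))
      else AAct True (ATau (abs_contract S A C)))"
| "abs_action S A (Split ws) =
     AAct False (ASplit (map snd (map (map_prod id (abs_contract S A)) ws)))"
| "abs_action S A (Rngt X es) = ARngt X"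

datatype ('p, 'n, 'x) aterm = ATContract "('p, 'x) acontract" 'n | ATRec 'x

type_synonym ('p, 'n, 'x) aconfig = "('p, 'n, 'x) aterm multiset"

definition acn :: "('p, 'n, 'x) aconfig \<Rightarrow> 'n set" where
  "acn \<Gamma> = {x. \<exists>C. ATContract C x \<in># \<Gamma>}"

fun abs_term ::
  "('p \<Rightarrow> 'a set) \<Rightarrow> 'p \<Rightarrow> 'n set \<Rightarrow> ('p, 'n, 'd, 'a, 'x) cterm \<Rightarrow> ('p, 'n, 'x) aconfig" where
  "abs_term S A \<X> (TContract C v x) = (if x \<in> \<X> then {#ATContract (abs_contract S A C) x#} else {#})"
| "abs_term S A \<X> _ = {#}"

definition abs_config ::
  "('p, 'n, 'd, 'a, 'x, 'b) bitml \<Rightarrow> 'p \<Rightarrow> 'n set \<Rightarrow> ('p, 'n, 'd, 'a, 'x) config \<Rightarrow> ('p, 'n, 'x) aconfig"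
where
  "abs_config M A \<X> \<Gamma> = (\<Sum>T\<in>#\<Gamma>. abs_term (secret_names M) A \<X> T)"

section \<open>Abstract semantics\<close>

(* ALabel False x is the label x, and ALabel True x is *:x. *)
datatype 'n alabel = ALabel bool 'n

fun star_label :: "'n alabel \<Rightarrow> 'n alabel" where
  "star_label (ALabel s x) = ALabel True x"

fun label_cn :: "'n alabel \<Rightarrow> 'n set" where
  "label_cn (ALabel s x) = {x}"

(* U: the names from which fresh names must be distinct. *)
inductive astep ::
  "('p, 'n, 'd, 'a, 'x, 'b) bitml \<Rightarrow> 'p \<Rightarrow> 'n set \<Rightarrow>
   ('p, 'n, 'x) aconfig \<Rightarrow> 'n alabel \<Rightarrow> ('p, 'n, 'x) aconfig \<Rightarrow> bool"
  for M :: "('p, 'n, 'd, 'a, 'x, 'b) bitml" and A :: 'p and U :: "'n set"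
where
  A_Withdraw:
  "astep M A U ({#ATContract (ASum {#AAct False (AWithdraw P)#}) x#} + \<Gamma>) (ALabel False x) \<Gamma>"
| A_Tau:
  "y \<notin> U \<Longrightarrow>
   astep M A U ({#ATContract (ASum {#AAct False (ATau C)#}) x#} + \<Gamma>) (ALabel False x)
     ({#ATContract C y#} + \<Gamma>)"
| A_Split:
  "\<lbrakk>length ys = length Cs; distinct ys; set ys \<inter> U = {}\<rbrakk> \<Longrightarrow>
   astep M A U ({#ATContract (ASum {#AAct False (ASplit Cs)#}) x#} + \<Gamma>) (ALabel False x)
     (mset (map (\<lambda>(C, y). ATContract C y) (zip Cs ys)) + \<Gamma>)"
| A_Sum:
  "\<lbrakk>astep M A U ({#ATContract (ASum {#D#}) x#} + \<Gamma>) l \<Gamma>'; x \<in> label_cn l\<rbrakk> \<Longrightarrow>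
   astep M A U ({#ATContract (ASum (add_mset D Ds)) x#} + \<Gamma>) l \<Gamma>'"
| A_Star:
  "\<lbrakk>astep M A U ({#ATContract (ASum {#D#}) x#} + \<Gamma>) l \<Gamma>'; x \<in> label_cn l\<rbrakk> \<Longrightarrow>
   astep M A U ({#ATContract (ASum {#star D#}) x#} + \<Gamma>) (star_label l) \<Gamma>'"
| A_Rngt:
  "\<lbrakk>C = abs_contract (secret_names M) A (eqn_body M X); y \<notin> U\<rbrakk> \<Longrightarrow>
   astep M A U ({#ATContract (ASum {#ARngt X#}) x#} + \<Gamma>) (ALabel True x)
     ({#ATContract C y, ATRec X#} + \<Gamma>)"

primrec arun ::
  "('p, 'n, 'd, 'a, 'x, 'b) bitml \<Rightarrow> 'p \<Rightarrow> 'n set \<Rightarrow>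
   (('p, 'n, 'x) aconfig, 'n alabel) run \<Rightarrow> bool" where
  "arun M A U (Start \<Gamma>) \<longleftrightarrow> True"
| "arun M A U (Extend R l \<Gamma>') \<longleftrightarrow>
     arun M A U R \<and> astep M A (U \<union> (\<Union>\<Gamma>\<in>run_configs R. acn \<Gamma>)) (run_last R) l \<Gamma>'"

definition asteps ::
  "('p, 'n, 'd, 'a, 'x, 'b) bitml \<Rightarrow> 'p \<Rightarrow> 'n set \<Rightarrow> ('p, 'n, 'x) aconfig \<Rightarrow> ('p, 'n, 'x) aconfig \<Rightarrow> bool"
where
  "asteps M A U \<Gamma> \<Gamma>' \<longleftrightarrow> (\<exists>R. arun M A U R \<and> run_first R = \<Gamma> \<and> run_last R = \<Gamma>')"

end

theory Submission
  imports Defs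
begin

text \<open>
  A concrete step either leaves the active contracts alone, or adds one with a fresh name (init), or
  replaces a single contract by contracts with fresh names; in the last case the abstract semantics
  can perform the same replacement, unless the contract is not tracked. A recursive call replaces a
  contract by a renamed instance of the defining equation. Renaming does not affect the abstraction:
  preconditions are well formed before and after it and the sets of secret names are disjoint, so
  a secret keeps its owner.
\<close>

section \<open>Active contracts of a configuration\<close>

text \<open>Balances are dropped because the abstraction forgets them. What is kept determines both
  \<open>cn\<close> and \<open>abs_config\<close>, so a concrete step can be studied through its
  effect on this multiset alone.\<close>

definition contracts ::
  "('p, 'n, 'd, 'a, 'x) config \<Rightarrow> (('p, 'a, 'x, int) contract \<times> 'n) multiset" where
  "contracts \<Gamma> = (\<Sum>T\<in>#\<Gamma>. case T of TContract C v x \<Rightarrow> {#(C, x)#} | _ \<Rightarrow> {#})"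

lemma contracts_simps [simp]:
  "contracts {#} = {#}"
  "contracts (\<Gamma> + \<Delta>) = contracts \<Gamma> + contracts \<Delta>"
  "contracts (add_mset (TContract C v x) \<Gamma>) = add_mset (C, x) (contracts \<Gamma>)"
  "contracts (add_mset (TAdv \<Phi>) \<Gamma>) = contracts \<Gamma>"
  "contracts (add_mset (TDep P v x) \<Gamma>) = contracts \<Gamma>"
  "contracts (add_mset (TAuth P \<xi>) \<Gamma>) = contracts \<Gamma>"
  "contracts (add_mset (TCommit P a k) \<Gamma>) = contracts \<Gamma>"
  "contracts (add_mset (TReveal P a N) \<Gamma>) = contracts \<Gamma>"
  "contracts (add_mset (TBind P d x) \<Gamma>) = contracts \<Gamma>"
  "contracts (add_mset (TTime t) \<Gamma>) = contracts \<Gamma>"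
  by (simp_all add: contracts_def)

lemma mem_contracts_iff: "(C, x) \<in># contracts \<Gamma> \<longleftrightarrow> (\<exists>v. TContract C v x \<in># \<Gamma>)"
proof (induction \<Gamma>)
  case (add T \<Gamma>)
  then show ?case by (cases T) auto
qed simp

lemma contracts_empty: "(\<And>C v x. TContract C v x \<notin># \<Gamma>) \<Longrightarrow> contracts \<Gamma> = {#}"
  by (metis mem_contracts_iff multiset_nonemptyE surj_pair)

lemma cn_eq_contracts: "cn \<Gamma> = snd ` set_mset (contracts \<Gamma>)"
  by (auto simp: cn_def image_iff mem_contracts_iff Bex_def) blast

lemma cn_subset_names_in: "\<Gamma> \<in> U \<Longrightarrow> cn \<Gamma> \<subseteq> names_in U"
  by (force simp: cn_def names_in_def)

lemma valid_contract_names: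
  assumes "valid M \<Gamma>"
  shows "count (image_mset snd (contracts \<Gamma>)) x \<le> 1"
proof -
  have "count (image_mset snd (contracts \<Gamma>)) x = size {#T \<in># \<Gamma>. \<exists>C v. T = TContract C v x#}"
  proof (induction \<Gamma>)
    case (add T \<Gamma>)
    then show ?case by (cases T) auto
  qed simp
  then show ?thesis using assms by (simp add: valid_def)
qed

lemma valid_adv: "valid M \<Gamma> \<Longrightarrow> TAdv \<Phi> \<in># \<Gamma> \<Longrightarrow> wf_advert M \<Phi>"
  by (auto simp: valid_def)

lemma contracts_stipulation [simp]: "contracts (stipulation G \<Phi> b) = {#}"
  by (rule contracts_empty) (auto simp: stipulation_def split: pre.splits depref.splits)

lemma contracts_auths [simp]: "contracts (image_mset (\<lambda>P. TAuth (f P) (g P)) K) = {#}"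
  by (rule contracts_empty) auto

section \<open>Abstraction and renaming\<close>

text \<open>The abstraction looks at secrets only through the test
  \<open>set as \<subseteq> S A\<close>, and at static expressions not at all:
  \<open>map_prd\<close> sends exactly \<open>PTrue\<close> to \<open>PTrue\<close>. Participants
  and recursion variables are mapped by \<open>id\<close>, so the decorations are judged as
  before.\<close>

lemma abs_map_contract:
  fixes C :: "('p, 'a, 'x, 'e) contract" and D :: "('p, 'a, 'x, 'e) guarded"
    and D' :: "('p, 'a, 'x, 'e) action"
  shows "(\<And>a. a \<in> c_secrets C \<Longrightarrow> \<rho> a \<in> S A \<longleftrightarrow> a \<in> S A) \<Longrightarrow>
      abs_contract S A (map_contract id \<rho> id f C) = abs_contract S A C"
    and "(\<And>a. a \<in> g_secrets D \<Longrightarrow> \<rho> a \<in> S A \<longleftrightarrow> a \<in> S A) \<Longrightarrow>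
      abs_guarded S A (map_guarded id \<rho> id f D) = abs_guarded S A D"
    and "(\<And>a. a \<in> d_secrets D' \<Longrightarrow> \<rho> a \<in> S A \<longleftrightarrow> a \<in> S A) \<Longrightarrow>
      abs_action S A (map_action id \<rho> id f D') = abs_action S A D'"
proof (induction C and D and D')
  case (Sum Ds)
  have "abs_guarded S A (map_guarded id \<rho> id f D) = abs_guarded S A D" if "D \<in># Ds" for D
    by (rule Sum.IH[OF that]) (use Sum.prems that in auto)
  then show ?case by (simp add: multiset.map_comp id_def cong: image_mset_cong)
next
  case (Guard Ps ts D)
  then show ?case by auto
next
  case (Reveal as p C)
  have "\<rho> ` set as \<subseteq> S A \<longleftrightarrow> set as \<subseteq> S A"
    using Reveal.prems by (auto simp: subset_iff)
  moreover have "map_prd \<rho> f p = PTrue \<longleftrightarrow> p = PTrue"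
    by (cases p) auto
  ultimately show ?case using Reveal by simp
next
  case (Split ws)
  have "abs_contract S A (map_contract id \<rho> id f (snd w)) = abs_contract S A (snd w)"
    if "w \<in> set ws" for w
  proof -
    \<comment> \<open>The recursion in \<open>Split\<close> runs through pairs, so the induction
      hypothesis speaks of members of \<open>snds w\<close>.\<close>
    have w: "snd w \<in> Basic_BNFs.snds w"
      by (simp add: snds.simps)
    show ?thesis
    proof (rule Split.IH[OF that w])
      fix a assume "a \<in> c_secrets (snd w)"
      then have "a \<in> d_secrets (Split ws)"
        using that w by auto
      then show "\<rho> a \<in> S A \<longleftrightarrow> a \<in> S A"
        by (rule Split.prems)
    qed
  qed
  then show ?case by (simp add: id_def)
qed simp_all

lemma rngt_equiv_abs:
  assumes M: "bitml_setting M" and eq: "rngt_equiv M X ks G C" and wf: "wf_adv M G C"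
  shows "abs_contract (secret_names M) A C = abs_contract (secret_names M) A (eqn_body M X)"
proof -
  obtain \<rho> \<sigma> f where G: "G = image_mset (map_pre id id \<sigma> \<rho>) (eqn_pre M X)"
    and C: "C = map_contract id \<rho> id f (eqn_body M X)"
    using eq by (auto simp: rngt_equiv_def Let_def)
  have wf': "wf_adv M (eqn_pre M X) (eqn_body M X)"
    using M by (simp add: bitml_setting_def)
  have "\<rho> a \<in> secret_names M A \<longleftrightarrow> a \<in> secret_names M A" if a: "a \<in> c_secrets (eqn_body M X)" for a
  proof -
    have "a \<in> secrets_of (eqn_pre M X)"
      using a wf' by (auto simp: wf_adv_def)
    then obtain g where g: "g \<in># eqn_pre M X" "a \<in> pre_secrets g"
      by (auto simp: secrets_of_def)
    then obtain P where P: "Secret P a \<in># eqn_pre M X"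
      by (cases g) auto
    then have "Secret P (\<rho> a) \<in># G"
      by (force simp: G)
    then have "\<rho> a \<in> secret_names M P" "a \<in> secret_names M P"
      using wf wf' P by (auto simp: wf_adv_def wf_pre_def)
    \<comment> \<open>If \<open>A = P\<close>, both memberships hold; otherwise disjointness from
      the secret names of \<open>P\<close> refutes both.\<close>
    then show ?thesis
      using M unfolding bitml_setting_def by (metis disjoint_iff)
  qed
  then show ?thesis unfolding C by (rule abs_map_contract)
qed

section \<open>Abstract configurations as images of contract multisets\<close>

definition abs_contracts ::
  "('p, 'n, 'd, 'a, 'x, 'b) bitml \<Rightarrow> 'p \<Rightarrow> (('p, 'a, 'x, int) contract \<times> 'n) multiset \<Rightarrow>
   ('p, 'n, 'x) aconfig" where
  "abs_contracts M A K = image_mset (\<lambda>(C, x). ATContract (abs_contract (secret_names M) A C) x) K"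

lemma abs_config_eq: "abs_config M A \<X> \<Gamma> = abs_contracts M A {#p \<in># contracts \<Gamma>. snd p \<in> \<X>#}"
  unfolding abs_config_def abs_contracts_def
proof (induction \<Gamma>)
  case (add T \<Gamma>)
  then show ?case by (cases T) auto
qed simp

lemma acn_abs_config: "acn (abs_config M A \<X> \<Gamma> + image_mset ATRec Xs) \<subseteq> cn \<Gamma>"
  by (force simp: acn_def abs_config_eq abs_contracts_def cn_eq_contracts)

section \<open>Simulation of a step\<close>

text \<open>\<open>F\<close> stands for the names used concretely and \<open>W\<close> for those the
  abstract run must avoid; since \<open>W \<subseteq> F\<close>, the names in \<open>N\<close>,
  chosen outside \<open>F\<close>, serve in both. The context \<open>\<Gamma>\<close> is arbitrary,
  and \<open>Xs\<close> is fixed before it, since the recursion variables produced depend only on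
  the contract. The label condition is the side condition of \<open>A_Sum\<close> and
  \<open>A_Star\<close>.\<close>

definition mirrored ::
  "('p, 'n, 'd, 'a, 'x, 'b) bitml \<Rightarrow> 'p \<Rightarrow> 'n set \<Rightarrow> ('p, 'x) acontract \<Rightarrow> 'n \<Rightarrow>
   (('p, 'a, 'x, int) contract \<times> 'n) multiset \<Rightarrow> bool" where
  "mirrored M A F C x N \<longleftrightarrow>
     (\<exists>Xs. \<forall>W \<Gamma>. W \<subseteq> F \<longrightarrow> (\<exists>l. x \<in> label_cn l \<and>
        astep M A W (add_mset (ATContract C x) \<Gamma>) l
          (abs_contracts M A N + image_mset ATRec Xs + \<Gamma>)))"

lemma label_cn_star [simp]: "label_cn (star_label l) = label_cn l"
  by (cases l) simp

text \<open>Handles the quantifiers of \<open>mirrored\<close> once: it is enough to turn each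
  single step into one with the same target.\<close>

lemma mirrored_mono:
  assumes "mirrored M A F C x N"
    and "\<And>W \<Gamma> l \<Gamma>'. \<lbrakk>astep M A W (add_mset (ATContract C x) \<Gamma>) l \<Gamma>'; x \<in> label_cn l\<rbrakk> \<Longrightarrow>
      \<exists>l'. x \<in> label_cn l' \<and> astep M A W (add_mset (ATContract C' x) \<Gamma>) l' \<Gamma>'"
  shows "mirrored M A F C' x N"
  using assms unfolding mirrored_def by metis

lemma mirrored_sum:
  assumes "mirrored M A F (ASum {#D#}) x N"
  shows "mirrored M A F (ASum (add_mset D Ds)) x N"
  using assms
proof (rule mirrored_mono)
  fix W \<Gamma> l \<Gamma>'
  assume "astep M A W (add_mset (ATContract (ASum {#D#}) x) \<Gamma>) l \<Gamma>'" "x \<in> label_cn l"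
  then show "\<exists>l'. x \<in> label_cn l' \<and> astep M A W (add_mset (ATContract (ASum (add_mset D Ds)) x) \<Gamma>) l' \<Gamma>'"
    using A_Sum[of M A W D x \<Gamma> l \<Gamma>' Ds] by (intro exI[of _ l]) simp
qed

lemma mirrored_star:
  assumes "mirrored M A F (ASum {#D#}) x N"
  shows "mirrored M A F (ASum {#star D#}) x N"
  using assms
proof (rule mirrored_mono)
  fix W \<Gamma> l \<Gamma>'
  assume "astep M A W (add_mset (ATContract (ASum {#D#}) x) \<Gamma>) l \<Gamma>'" "x \<in> label_cn l"
  then show "\<exists>l'. x \<in> label_cn l' \<and> astep M A W (add_mset (ATContract (ASum {#star D#}) x) \<Gamma>) l' \<Gamma>'"
    using A_Star[of M A W D x \<Gamma> l \<Gamma>'] by (intro exI[of _ "star_label l"]) simp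
qed

text \<open>Abstract counterpart of \<open>C_Branch\<close>: time constraints disappear, decorations
  leave at most a star, and the alternatives are discarded by \<open>A_Sum\<close>. The two facts
  supplied cover the unstarred and the starred case.\<close>

lemma mirrored_guarded:
  assumes "mirrored M A F (abs_contract S B (single D')) x N"
  shows "mirrored M A F (abs_contract S B (Sum (add_mset (Guard Ps ts D') Ds))) x N"
  using mirrored_sum[OF assms[simplified]] mirrored_sum[OF mirrored_star[OF assms[simplified]]]
  by simp

lemma mirrored_withdraw:
  "mirrored M A F (abs_contract S B (single (Withdraw P))) x {#}"
proof -
  have "\<exists>l. x \<in> label_cn l \<and>
      astep M A W (add_mset (ATContract (ASum {#AAct False (AWithdraw P)#}) x) \<Gamma>) l \<Gamma>" for W \<Gamma>
    using A_Withdraw[of M A W P x \<Gamma>] by (intro exI[of _ "ALabel False x"]) simp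
  then show ?thesis
    by (auto simp: mirrored_def abs_contracts_def intro: exI[of _ "{#}"])
qed

lemma mirrored_reveal:
  assumes "y \<notin> F"
  shows "mirrored M A F (abs_contract (secret_names M) A (single (Reveal as p C))) x {#(C, y)#}"
proof -
  let ?C = "abs_contract (secret_names M) A C"
  have "\<exists>l. x \<in> label_cn l \<and> astep M A W (add_mset (ATContract (ASum {#AAct False (ATau ?C)#}) x) \<Gamma>) l
      (add_mset (ATContract ?C y) \<Gamma>)" if "W \<subseteq> F" for W \<Gamma>
    using A_Tau[of y W M A ?C x \<Gamma>] assms that by (intro exI[of _ "ALabel False x"]) auto
  then have *: "mirrored M A F (ASum {#AAct False (ATau ?C)#}) x {#(C, y)#}"
    by (auto simp: mirrored_def abs_contracts_def intro!: exI[of _ "{#}"])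
  show ?thesis using * mirrored_star[OF *] by simp
qed

lemma mirrored_split:
  assumes "length ys = length ws" "distinct ys" "set ys \<inter> F = {}"
  shows "mirrored M A F (abs_contract (secret_names M) A (single (Split ws))) x
    (mset (zip (map snd ws) ys))"
proof -
  let ?Cs = "map (abs_contract (secret_names M) A \<circ> snd) ws"
  have eq: "abs_contracts M A (mset (zip (map snd ws) ys)) = mset (map (\<lambda>(C, y). ATContract C y) (zip ?Cs ys))"
    by (auto simp: abs_contracts_def zip_map1 simp flip: mset_map intro!: arg_cong[where f = mset])
  have "\<exists>l. x \<in> label_cn l \<and> astep M A W (add_mset (ATContract (ASum {#AAct False (ASplit ?Cs)#}) x) \<Gamma>) l
      (mset (map (\<lambda>(C, y). ATContract C y) (zip ?Cs ys)) + \<Gamma>)" if "W \<subseteq> F" for W \<Gamma>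
    using A_Split[of ys ?Cs W M A x \<Gamma>] assms that by (intro exI[of _ "ALabel False x"]) auto
  then have "mirrored M A F (ASum {#AAct False (ASplit ?Cs)#}) x (mset (zip (map snd ws) ys))"
    unfolding mirrored_def eq by (intro exI[of _ "{#}"]) simp
  then show ?thesis by (simp add: comp_def)
qed

text \<open>The abstract step unfolds the body of the equation, whereas the concrete one produces an
  instance \<open>C\<close>; the second hypothesis identifies their abstractions. This is the only
  source of recursion variables, hence the witness \<open>{#X#}\<close>.\<close>

lemma mirrored_rngt:
  assumes "y \<notin> F"
    and "abs_contract (secret_names M) A C = abs_contract (secret_names M) A (eqn_body M X)"
  shows "mirrored M A F (abs_contract S B (single (Rngt X ks))) x {#(C, y)#}"
proof -
  let ?C = "abs_contract (secret_names M) A C"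
  have "\<exists>l. x \<in> label_cn l \<and> astep M A W (add_mset (ATContract (ASum {#ARngt X#}) x) \<Gamma>) l
      (add_mset (ATContract ?C y) (add_mset (ATRec X) \<Gamma>))" if "W \<subseteq> F" for W \<Gamma>
    using A_Rngt[of ?C M A X y W x \<Gamma>] assms that by (intro exI[of _ "ALabel True x"]) auto
  then show ?thesis
    by (auto simp: mirrored_def abs_contracts_def intro!: exI[of _ "{#X#}"])
qed

text \<open>Induction on the derivation, as \<open>C_Branch\<close> has a step as premise. Instead
  of validity, only well-formed advertisements and unique contract names are assumed, since both
  pass directly to the configuration in that premise.\<close>

lemma cstep_contracts_cases:
  assumes "cstep M U \<Gamma> l \<Gamma>'"
    and M: "bitml_setting M"
    and "\<And>\<Phi>. TAdv \<Phi> \<in># \<Gamma> \<Longrightarrow> wf_advert M \<Phi>"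
    and "\<And>x. count (image_mset snd (contracts \<Gamma>)) x \<le> 1"
  shows "contracts \<Gamma>' = contracts \<Gamma> \<or>
    (\<exists>C z. z \<notin> names_in U \<and> contracts \<Gamma>' = add_mset (C, z) (contracts \<Gamma>)) \<or>
    (\<exists>C x \<Delta> N. contracts \<Gamma> = add_mset (C, x) \<Delta> \<and> contracts \<Gamma>' = N + \<Delta> \<and>
       snd ` set_mset N \<inter> names_in U = {} \<and>
       mirrored M A (names_in U) (abs_contract (secret_names M) A C) x N)"
    (is "?same \<Gamma> \<Gamma>' \<or> ?new \<Gamma> \<Gamma>' \<or> ?repl \<Gamma> \<Gamma>'")
  using assms(1,3,4)
proof (induction \<Gamma> l \<Gamma>' rule: cstep.induct)
  case (AuthDestroy \<Delta> ds xs j P y \<Gamma>)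
  then show ?case by simp
next
  case (Destroy \<Delta> ds xs \<Delta>' y \<Gamma>)
  have "contracts \<Delta> = {#}" "contracts \<Delta>' = {#}"
    using Destroy by (auto intro!: contracts_empty)
  then show ?case by simp
next
  case (C_AuthCommit \<Phi> G c C as P \<Gamma> N \<Delta>\<^sub>s ds b \<Delta>\<^sub>d)
  have "contracts \<Delta>\<^sub>s = {#}" "contracts \<Delta>\<^sub>d = {#}"
    using C_AuthCommit by (auto intro!: contracts_empty)
  then show ?case by simp
next
  case (C_Init \<Phi> C \<Delta> G b z \<Gamma>)
  then show ?case by auto
next
  case (C_Withdraw y P v x \<Gamma>)
  have "?repl ({#TContract (single (Withdraw P)) v x#} + \<Gamma>) ({#TDep P v y#} + \<Gamma>)"
    by (intro exI conjI) (auto intro: mirrored_withdraw simp del: abs_contract.simps)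
  then show ?case by blast
next
  case (C_Split ys ws v x \<Gamma>)
  let ?f = "\<lambda>((w, C), y). TContract C (v * w / sum_list (map fst ws)) y"
  \<comment> \<open>Generalised from \<open>ws\<close> to \<open>us\<close>, because the total
    weight of \<open>ws\<close> inside \<open>?f\<close> must stay fixed while the list
    shrinks.\<close>
  have "contracts (mset (map ?f (zip us ys))) = mset (zip (map snd us) ys)" for us
  proof (induction us arbitrary: ys)
    case (Cons u us)
    then show ?case by (cases ys; cases u) auto
  qed simp
  then have eq: "contracts (mset (map ?f (zip ws ys)) + \<Gamma>) = mset (zip (map snd ws) ys) + contracts \<Gamma>"
    by simp
  have "snd ` set_mset (mset (zip (map snd ws) ys)) \<inter> names_in U = {}"
    using C_Split by (auto dest: set_zip_rightD)
  moreover have "mirrored M A (names_in U) (abs_contract (secret_names M) A (single (Split ws))) x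
    (mset (zip (map snd ws) ys))"
    using C_Split by (intro mirrored_split)
  ultimately have "?repl ({#TContract (single (Split ws)) v x#} + \<Gamma>) (mset (map ?f (zip ws ys)) + \<Gamma>)"
    using eq by (intro exI conjI) (auto simp del: abs_contract.simps)
  then show ?case by blast
next
  case (C_Rev \<Delta> Q N as p y C v x \<Gamma>)
  have "contracts \<Delta> = {#}"
    using C_Rev by (auto intro!: contracts_empty)
  moreover have "mirrored M A (names_in U)
    (abs_contract (secret_names M) A (single (Reveal as p C))) x {#(C, y)#}"
    using C_Rev by (intro mirrored_reveal)
  ultimately have "?repl ({#TContract (single (Reveal as p C)) v x#} + \<Gamma> + \<Delta>) ({#TContract C v y#} + \<Gamma> + \<Delta>)"
    using C_Rev.hyps by (intro exI[of _ "single (Reveal as p C)"] exI[of _ x] exI[of _ "contracts \<Gamma>"]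
      exI[of _ "{#(C, y)#}"] conjI) (auto simp del: abs_contract.simps)
  then show ?case by blast
next
  case (C_Branch D Ps ts D' v x \<Gamma> l \<Gamma>' t Ds)
  let ?\<Gamma> = "{#TContract (single D') v x#} + \<Gamma>"
  have count: "count (image_mset snd (contracts ?\<Gamma>)) z \<le> 1" for z
    using C_Branch.prems(2)[of z] by simp
  have x: "x \<notin> snd ` set_mset (contracts \<Gamma>')"
    using C_Branch.hyps by (simp add: cn_eq_contracts)
  have "?same ?\<Gamma> \<Gamma>' \<or> ?new ?\<Gamma> \<Gamma>' \<or> ?repl ?\<Gamma> \<Gamma>'"
    by (rule C_Branch.IH) (use C_Branch.prems(1) count in auto)
  \<comment> \<open>The other two alternatives would keep \<open>x\<close> active.\<close>
  then have "?repl ?\<Gamma> \<Gamma>'"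
    using x by auto
  then obtain C x' \<Delta> N where r: "add_mset (single D', x) (contracts \<Gamma>) = add_mset (C, x') \<Delta>"
    "contracts \<Gamma>' = N + \<Delta>" "snd ` set_mset N \<inter> names_in U = {}"
    "mirrored M A (names_in U) (abs_contract (secret_names M) A C) x' N"
    by (auto simp del: abs_contract.simps)
  \<comment> \<open>The replaced contract must be the one named \<open>x\<close>: as a member of
    \<open>\<Delta>\<close> it would survive into \<open>\<Gamma>'\<close>.\<close>
  have "(single D', x) \<notin># \<Delta>"
    using x r(2) by force
  then have eq: "C = single D'" "x' = x" "\<Delta> = contracts \<Gamma>"
    using r(1) by (auto simp: add_eq_conv_ex)
  have "mirrored M A (names_in U) (abs_contract (secret_names M) A (Sum (add_mset D Ds))) x N"
    unfolding C_Branch.hyps(1) by (rule mirrored_guarded) (use r(4) eq in simp)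
  then show ?case using r(2,3) eq
    by (intro disjI2 exI[of _ "Sum (add_mset D Ds)"] exI[of _ x] exI[of _ "contracts \<Gamma>"] exI[of _ N])
       (auto simp del: abs_contract.simps)
next
  case (C_Rngt X ks G C \<Phi> x \<Delta> b y Ds v \<Gamma>)
  \<comment> \<open>The consumed advertisement belongs to the configuration, so the renamed
    precondition is well formed too, as the renaming argument requires.\<close>
  have "wf_advert M \<Phi>"
    by (rule C_Rngt.prems(1)) simp
  then have "abs_contract (secret_names M) A C = abs_contract (secret_names M) A (eqn_body M X)"
    using C_Rngt.hyps by (intro rngt_equiv_abs[OF M]) auto
  then have "mirrored M A (names_in U) (abs_contract (secret_names M) A
     (Sum (add_mset (Guard {||} {#} (Rngt X ks)) Ds))) x {#(C, y)#}"
    by (rule mirrored_guarded[OF mirrored_rngt[OF C_Rngt.hyps(4)]])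
  moreover have "contracts \<Delta> = {#}"
    using C_Rngt.hyps by simp
  ultimately show ?case using C_Rngt.hyps(4)
    by (intro disjI2 exI[of _ "Sum (add_mset (Guard {||} {#} (Rngt X ks)) Ds)"] exI[of _ x]
        exI[of _ "contracts \<Gamma>"] exI[of _ "{#(C, y)#}"]) (auto simp del: abs_contract.simps)
qed simp_all

section \<open>Simulation of a run\<close>

lemma crun_last: "crun M U R \<Longrightarrow> valid M (run_last R)"
  by (cases R) auto

lemma run_first_in_configs: "run_first R \<in> run_configs R"
  by (induction R) auto

lemma run_last_in_configs: "run_last R \<in> run_configs R"
  by (cases R) auto

lemma abs_config_cong:
  "(\<And>x. x \<in> cn \<Gamma> \<Longrightarrow> x \<in> \<X> \<longleftrightarrow> x \<in> \<Y>) \<Longrightarrow> abs_config M A \<X> \<Gamma> = abs_config M A \<Y> \<Gamma>"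
  unfolding abs_config_eq
  by (rule arg_cong[where f = "abs_contracts M A"])
     (rule filter_mset_cong[OF refl], auto simp: cn_eq_contracts)

section \<open>Descendants after one more step\<close>

lemma desc_Extend_kept:
  "x \<in> cn (run_last R) \<Longrightarrow> x \<in> cn \<Gamma>' \<Longrightarrow> x \<in> desc (Extend R l \<Gamma>') \<X> \<longleftrightarrow> x \<in> desc R \<X>"
  by (auto simp: desc_def)

lemma desc_Extend_new:
  assumes "z \<in> cn \<Gamma>' - cn (run_last R)" and "cn (run_last R) - cn \<Gamma>' = {x}"
  shows "z \<in> desc (Extend R l \<Gamma>') \<X> \<longleftrightarrow> x \<in> desc R \<X>"
  using assms by (auto simp: desc_def)

text \<open>With no contract vanishing there is no parent to inherit from, so \<open>orig\<close> is
  undefined at \<open>z\<close>. This is how contracts stipulated by \<open>C_Init\<close> stay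
  untracked.\<close>

lemma desc_Extend_orphan:
  assumes "z \<notin> cn (run_last R)" and "cn (run_last R) - cn \<Gamma>' = {}"
  shows "z \<notin> desc (Extend R l \<Gamma>') \<X>"
  using assms by (auto simp: desc_def is_singleton_def)

text \<open>Exactly \<open>x\<close> vanishes, so the members of \<open>N\<close> are tracked if and
  only if \<open>x\<close> was, while those of \<open>\<Delta>\<close> keep their status. Both
  configurations are split with the same last summand, which then serves as context for
  \<open>mirrored\<close>.\<close>

lemma abs_config_Extend:
  assumes "contracts (run_last R) = add_mset (C, x) \<Delta>" and "contracts \<Gamma>' = N + \<Delta>"
    and "\<And>z. count (image_mset snd (contracts (run_last R))) z \<le> 1"
    and "snd ` set_mset N \<inter> cn (run_last R) = {}"
  shows "abs_config M A (desc R \<X>) (run_last R) =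
      (if x \<in> desc R \<X> then {#ATContract (abs_contract (secret_names M) A C) x#} else {#})
      + abs_contracts M A {#p \<in># \<Delta>. snd p \<in> desc R \<X>#}"
    and "abs_config M A (desc (Extend R l \<Gamma>') \<X>) \<Gamma>' =
      (if x \<in> desc R \<X> then abs_contracts M A N else {#})
      + abs_contracts M A {#p \<in># \<Delta>. snd p \<in> desc R \<X>#}"
proof -
  show "abs_config M A (desc R \<X>) (run_last R) =
      (if x \<in> desc R \<X> then {#ATContract (abs_contract (secret_names M) A C) x#} else {#})
      + abs_contracts M A {#p \<in># \<Delta>. snd p \<in> desc R \<X>#}"
    unfolding abs_config_eq assms(1) by (simp add: abs_contracts_def)
  \<comment> \<open>Uniqueness of names: the removed pair already accounts for the one occurrence of
    \<open>x\<close>.\<close>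
  have x\<Delta>: "x \<notin> snd ` set_mset \<Delta>"
    using assms(3)[of x] by (simp add: assms(1) count_eq_zero_iff flip: set_image_mset)
  have cn: "cn (run_last R) = insert x (snd ` set_mset \<Delta>)"
    "cn \<Gamma>' = snd ` set_mset N \<union> snd ` set_mset \<Delta>"
    by (simp_all add: cn_eq_contracts assms(1,2) image_Un)
  have gone: "cn (run_last R) - cn \<Gamma>' = {x}"
    using x\<Delta> assms(4) cn by auto
  have N: "{#p \<in># N. snd p \<in> desc (Extend R l \<Gamma>') \<X>#} = (if x \<in> desc R \<X> then N else {#})"
  proof -
    have "snd p \<in> desc (Extend R l \<Gamma>') \<X> \<longleftrightarrow> x \<in> desc R \<X>" if "p \<in># N" for p
      by (rule desc_Extend_new[OF _ gone]) (use that assms(4) cn in auto)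
    then have "{#p \<in># N. snd p \<in> desc (Extend R l \<Gamma>') \<X>#} = {#p \<in># N. x \<in> desc R \<X>#}"
      by (intro filter_mset_cong) auto
    then show ?thesis by simp
  qed
  have "snd p \<in> desc (Extend R l \<Gamma>') \<X> \<longleftrightarrow> snd p \<in> desc R \<X>" if "p \<in># \<Delta>" for p
    by (rule desc_Extend_kept) (use that cn in auto)
  then have \<Delta>: "{#p \<in># \<Delta>. snd p \<in> desc (Extend R l \<Gamma>') \<X>#} = {#p \<in># \<Delta>. snd p \<in> desc R \<X>#}"
    by (intro filter_mset_cong) auto
  show "abs_config M A (desc (Extend R l \<Gamma>') \<X>) \<Gamma>' =
      (if x \<in> desc R \<X> then abs_contracts M A N else {#})
      + abs_contracts M A {#p \<in># \<Delta>. snd p \<in> desc R \<X>#}"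
    unfolding abs_config_eq assms(2) filter_union_mset N \<Delta> by (simp add: abs_contracts_def)
qed

text \<open>\<open>Ys\<close> stands for the recursion variables left by earlier steps, and
  \<open>W\<close> for whatever names the abstract run built so far has to avoid. The first
  alternative is a concrete step that the abstract run skips.\<close>

lemma cstep_abs_config:
  assumes M: "bitml_setting M" and valid: "valid M (run_last R)"
    and step: "cstep M U (run_last R) l \<Gamma>'" and U: "run_last R \<in> U"
  shows "abs_config M A (desc (Extend R l \<Gamma>') \<X>) \<Gamma>' = abs_config M A (desc R \<X>) (run_last R) \<or>
    (\<exists>Xs. \<forall>W Ys. W \<subseteq> names_in U \<longrightarrow>
      (\<exists>l'. astep M A W (abs_config M A (desc R \<X>) (run_last R) + image_mset ATRec Ys) l'
         (abs_config M A (desc (Extend R l \<Gamma>') \<X>) \<Gamma>' + image_mset ATRec (Xs + Ys))))"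
    (is "?same \<or> ?step")
proof -
  let ?\<Gamma> = "run_last R"
  have fresh: "cn ?\<Gamma> \<subseteq> names_in U"
    using U by (rule cn_subset_names_in)
  note count = valid_contract_names[OF valid]
  consider (same) "contracts \<Gamma>' = contracts ?\<Gamma>"
    | (new) C z where "z \<notin> names_in U" "contracts \<Gamma>' = add_mset (C, z) (contracts ?\<Gamma>)"
    | (repl) C x \<Delta> N where "contracts ?\<Gamma> = add_mset (C, x) \<Delta>" "contracts \<Gamma>' = N + \<Delta>"
       "snd ` set_mset N \<inter> names_in U = {}"
       "mirrored M A (names_in U) (abs_contract (secret_names M) A C) x N"
    using cstep_contracts_cases[OF step M valid_adv[OF valid] count, of A] by blast
  then show ?thesis
  proof cases
    case same
    then have cn: "cn \<Gamma>' = cn ?\<Gamma>"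
      by (simp add: cn_eq_contracts)
    have "abs_config M A (desc R \<X>) ?\<Gamma> = abs_config M A (desc (Extend R l \<Gamma>') \<X>) ?\<Gamma>"
      by (rule abs_config_cong) (simp add: desc_Extend_kept cn)
    then show ?thesis using same by (simp add: abs_config_eq)
  next
    case new
    then have cn: "cn \<Gamma>' = insert z (cn ?\<Gamma>)"
      by (simp add: cn_eq_contracts)
    have "z \<notin> desc (Extend R l \<Gamma>') \<X>"
      by (rule desc_Extend_orphan) (use new(1) cn fresh in auto)
    moreover have "abs_config M A (desc R \<X>) ?\<Gamma> = abs_config M A (desc (Extend R l \<Gamma>') \<X>) ?\<Gamma>"
      by (rule abs_config_cong) (simp add: desc_Extend_kept cn)
    ultimately show ?thesis using new(2) by (simp add: abs_config_eq)
  next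
    case repl
    have N: "snd ` set_mset N \<inter> cn ?\<Gamma> = {}"
      using repl(3) fresh by auto
    note eqs = abs_config_Extend[OF repl(1,2) count N, where M = M and A = A and \<X> = \<X>]
    show ?thesis
    proof (cases "x \<in> desc R \<X>")
      case True
      obtain Xs where Xs: "\<forall>W \<Delta>. W \<subseteq> names_in U \<longrightarrow>
        (\<exists>l. x \<in> label_cn l \<and> astep M A W (add_mset (ATContract (abs_contract (secret_names M) A C) x) \<Delta>) l
          (abs_contracts M A N + image_mset ATRec Xs + \<Delta>))"
        using repl(4) unfolding mirrored_def by (elim exE)
      have ?step
      proof (intro exI[of _ Xs] allI impI)
        fix W Ys
        assume W: "W \<subseteq> names_in U"
        show "\<exists>l'. astep M A W (abs_config M A (desc R \<X>) ?\<Gamma> + image_mset ATRec Ys) l'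
          (abs_config M A (desc (Extend R l \<Gamma>') \<X>) \<Gamma>' + image_mset ATRec (Xs + Ys))"
          \<comment> \<open>The context consists of the other tracked contracts and the earlier
            recursion variables.\<close>
          using Xs[rule_format, OF W, of "abs_contracts M A {#p \<in># \<Delta>. snd p \<in> desc R \<X>#} + image_mset ATRec Ys"]
          by (auto simp: eqs True ac_simps)
      qed
      then show ?thesis ..
    next
      case False
      \<comment> \<open>The contract is untracked, hence so are its successors, and both
        abstractions reduce to the tracked part of \<open>\<Delta>\<close>.\<close>
      then show ?thesis by (simp add: eqs)
    qed
  qed
qed

text \<open>Induction on the concrete run. The last conjunct is the added invariant: every contract
  name of the abstract run already occurs on the concrete side, so concretely fresh names are fresh
  abstractly.\<close>

lemma crun_abs_run:
  assumes M: "bitml_setting M" and "crun M U R" and "\<X> \<subseteq> cn (run_first R)"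
  shows "\<exists>R' Xs. arun M A (names_in (insert (run_first R) U)) R' \<and>
    run_first R' = abs_config M A \<X> (run_first R) \<and>
    run_last R' = abs_config M A (desc R \<X>) (run_last R) + image_mset ATRec Xs \<and>
    (\<Union>\<Gamma>\<in>run_configs R'. acn \<Gamma>) \<subseteq> names_in (U \<union> run_configs R)"
  using assms(2,3)
proof (induction R)
  case (Start \<Gamma>)
  \<comment> \<open>Initially each contract is its own origin;
    \<open>\<X> \<subseteq> cn \<Gamma>\<close> ensures that intersecting with
    \<open>cn \<Gamma>\<close> loses nothing.\<close>
  have "desc (Start \<Gamma> :: (_, ('a, 'b, 'c, 'd, 'e) label) run) \<X> = \<X>"
    using Start.prems by (auto simp: desc_def)
  moreover have "acn (abs_config M A \<X> \<Gamma>) \<subseteq> names_in (insert \<Gamma> U)"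
    using acn_abs_config[of M A \<X> \<Gamma> "{#}"] cn_subset_names_in[of \<Gamma> "insert \<Gamma> U"] by auto
  ultimately show ?case
    by (intro exI[of _ "Start (abs_config M A \<X> \<Gamma>)"] exI[of _ "{#}"]) simp
next
  case (Extend R l \<Gamma>')
  let ?V = "U \<union> run_configs R" and ?V' = "U \<union> run_configs (Extend R l \<Gamma>')"
  let ?F = "names_in (insert (run_first R) U)"
  have mono: "names_in ?V \<subseteq> names_in ?V'"
    by (auto simp: names_in_def)
  obtain R' Xs where R': "arun M A ?F R'" "run_first R' = abs_config M A \<X> (run_first R)"
    "run_last R' = abs_config M A (desc R \<X>) (run_last R) + image_mset ATRec Xs"
    "(\<Union>\<Gamma>\<in>run_configs R'. acn \<Gamma>) \<subseteq> names_in ?V"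
    using Extend by auto
  have "cstep M ?V (run_last R) l \<Gamma>'" "valid M (run_last R)" "run_last R \<in> ?V"
    using Extend.prems by (auto simp: crun_last run_last_in_configs)
  then consider (same) "abs_config M A (desc (Extend R l \<Gamma>') \<X>) \<Gamma>' = abs_config M A (desc R \<X>) (run_last R)"
    | (step) Zs where "\<And>W Ys. W \<subseteq> names_in ?V \<Longrightarrow>
      \<exists>l'. astep M A W (abs_config M A (desc R \<X>) (run_last R) + image_mset ATRec Ys) l'
         (abs_config M A (desc (Extend R l \<Gamma>') \<X>) \<Gamma>' + image_mset ATRec (Zs + Ys))"
    using cstep_abs_config[OF M, of R ?V l \<Gamma>' A \<X>] by blast
  then show ?case
  proof cases
    case same
    then show ?thesis using R' mono
      by (intro exI[of _ R'] exI[of _ Xs]) auto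
  next
    case step
    \<comment> \<open>Precisely the names that \<open>arun\<close> requires the next step to avoid;
      the invariant places them inside \<open>names_in ?V\<close>.\<close>
    let ?W = "?F \<union> (\<Union>\<Gamma>\<in>run_configs R'. acn \<Gamma>)"
    let ?\<Delta> = "abs_config M A (desc (Extend R l \<Gamma>') \<X>) \<Gamma>' + image_mset ATRec (Zs + Xs)"
    have "?F \<subseteq> names_in ?V"
      using run_first_in_configs[of R] by (auto simp: names_in_def)
    then obtain l' where l': "astep M A ?W (run_last R') l' ?\<Delta>"
      using step[of ?W Xs] R'(3,4) by auto
    have "acn ?\<Delta> \<subseteq> names_in ?V'"
      using acn_abs_config[of M A _ \<Gamma>' "Zs + Xs"] cn_subset_names_in[of \<Gamma>' ?V'] by fastforce
    then show ?thesis using R' l' mono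
      by (intro exI[of _ "Extend R' l' ?\<Delta>"] exI[of _ "Zs + Xs"]) auto
  qed
qed

theorem theorem5p4:
  fixes M :: "('p, 'n, 'd, 'a, 'x, 'b) bitml"
    and A :: 'p
    and \<Gamma> \<Gamma>' :: "('p, 'n, 'd, 'a, 'x) config"
    and \<X> :: "'n set"
    and U :: "('p, 'n, 'd, 'a, 'x) config set"
    and R :: "(('p, 'n, 'd, 'a, 'x) config, ('p, 'n, 'd, 'a, 'x) label) run"
  assumes "bitml_setting M"
    and "A \<in> honest M"
    and "creachable M \<Gamma>"
    and "\<X> \<subseteq> cn \<Gamma>"
    and "crun M U R" and "run_first R = \<Gamma>" and "run_last R = \<Gamma>'"
  shows "\<exists>Xs :: 'x multiset.
    asteps M A (names_in (insert \<Gamma> U))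
      (abs_config M A \<X> \<Gamma>)
      (abs_config M A (desc R \<X>) \<Gamma>' + image_mset ATRec Xs)"
  using crun_abs_run[of M U R \<X> A] assms unfolding asteps_def by blast

end
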